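(* Let $n\ge 1$ and let $B=B_1\cdots B_n$ be a string of length $n$ over $\{\mathrm{H},\mathrm{T}\}$, chosen by Bob. In each of the following cases Alice, choosing her string afterward, can force a loss for herself, i.e. there exists a string $A\neq B$ of length $n$ such that Bob wins the No-Flippancy game with Alice's string $A$ and Bob's string $B$: 1. $n$ is even. 2. $B$ starts with $\mathrm{HT}$. 3. $B$ starts with an even number of $\mathrm{H}$s, i.e. the maximal initial run of $\mathrm{H}$s in $B$ has positive even length. 4. $B$ starts with an odd number of $\mathrm{H}$s followed by at least two $\mathrm{T}$s, i.e. there is an odd $x\ge 1$ with $x+2\le n$, $B_1=\cdots=B_x=\mathrm{H}$ and $B_{x+1}=B_{x+2}=\mathrm{T}$.
   Context: No-Flippancy game: Alice and Bob have distinct strings $A=A_1\cdots A_n$ and $B=B_1\cdots B_n$ of the same length $n$ over the alphabet $\{\mathrm{H},\mathrm{T}\}$. Starting from the empty sequence, the players alternate turns, Alice going first, and on each turn the current player appends one letter to the sequence (the game output) as follows: let $i<n$ be the maximal length of a suffix of the current sequence that coincides with a prefix of the current player's string ($i=0$ is allowed, via the empty suffix); the player appends the letter with index $i+1$ of their own string. The game ends as soon as $A$ or $B$ appears as a block of consecutive letters in the sequence (necessarily as its suffix, no matter who made the last move); the player whose string appears first wins and the other loses. If neither string ever appears, the game is infinite (nobody wins). *)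

theory Defs
  imports Main "HOL-Library.Sublist"
begin

datatype coin = H | T

definition overlap :: "'a list \<Rightarrow> 'a list \<Rightarrow> nat" where
  "overlap S s = Max {i. i < length S \<and> suffix (take i S) s}"

text \<open>List indices start at 0, so the entry at position \<open>i\<close> is the letter that
  comes after the matched prefix of length \<open>i\<close>.\<close>

definition next_letter :: "'a list \<Rightarrow> 'a list \<Rightarrow> 'a" where
  "next_letter S s = S ! overlap S s"

definition game_over :: "'a list \<Rightarrow> 'a list \<Rightarrow> 'a list \<Rightarrow> bool" where
  "game_over A B s \<longleftrightarrow> sublist A s \<or> sublist B s"

text \<open>The sequence after (at most) \<open>k\<close> turns. Once the game is over it stays
  constant, so only sequences of the actual game occur as values.\<close>

primrec game_output :: "'a list \<Rightarrow> 'a list \<Rightarrow> nat \<Rightarrow> 'a list" where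
  "game_output A B 0 = []"
| "game_output A B (Suc k) =
     (let s = game_output A B k in
      if game_over A B s then s
      else s @ [next_letter (if even k then A else B) s])"

text \<open>The output is frozen as soon as one of the two strings appears, so a string
  occurring in it without the other one is the string that appears first.\<close>

definition bob_wins :: "'a list \<Rightarrow> 'a list \<Rightarrow> bool" where
  "bob_wins A B \<longleftrightarrow> (\<exists>k. sublist B (game_output A B k) \<and> \<not> sublist A (game_output A B k))"

end

theory Submission
  imports Defs
begin

text \<open>
  Call a start position in a sequence \<open>alive\<close> for a player if the rest of the sequence from there on
  is a prefix of that player's string; a player always continues the leftmost alive position.
  If \<open>n\<close> is even, Alice takes \<open>B\<close> with the last letter changed, so both follow \<open>B\<close> and Bob makes the
  last move. Otherwise Alice takes a proper tail of \<open>B\<close> (arbitrarily padded): once her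
  leftmost alive position lies inside a copy of \<open>B\<close>, she helps Bob to complete it, and she is too
  late to complete her own string.
  \<^item> If \<open>B\<close> starts with exactly \<open>r\<close> letters \<open>H\<close>, the tail \<open>B\<^sub>2 \<dots> B\<^sub>n\<close> starts with \<open>r - 1\<close> of them. For even
    \<open>r\<close> the output is \<open>B\<close>, as it is Bob who plays the \<open>r\<close>th \<open>H\<close>.
    For odd \<open>r\<close> Alice spoils the first attempt, and the output is \<open>H \<dots> H T B\<close> with
    \<open>r - 1\<close> letters \<open>H\<close> in front.
  \<^item> If \<open>B\<close> starts with \<open>HT\<close>, she takes the tail of \<open>B\<close> from the first repeated letter \<open>cc\<close> on (or
    \<open>H \<dots> H\<close> if \<open>B\<close> alternates), and the output is \<open>B\<close> or \<open>T B\<close>, according to \<open>c\<close>.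
\<close>

section \<open>Moves as leftmost alive positions\<close>

lemma suffix_take_iff:
  assumes "p \<le> t" "t \<le> length W" "t - p \<le> length S"
  shows "suffix (take (t - p) S) (take t W) \<longleftrightarrow> (\<forall>m<t - p. W ! (p + m) = S ! m)"
proof -
  have "suffix (take (t - p) S) (take t W) \<longleftrightarrow> drop p (take t W) = take (t - p) S"
  proof
    assume "suffix (take (t - p) S) (take t W)"
    then obtain X where X: "take t W = X @ take (t - p) S" by (auto simp: suffix_def)
    from arg_cong[OF this, of length] assms have "length X = p" by simp
    then show "drop p (take t W) = take (t - p) S" by (simp add: X)
  next
    assume "drop p (take t W) = take (t - p) S"
    then show "suffix (take (t - p) S) (take t W)" by (metis suffix_drop)
  qed
  also have "\<dots> \<longleftrightarrow> (\<forall>m<t - p. W ! (p + m) = S ! m)"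
    using assms by (auto simp: list_eq_iff_nth_eq)
  finally show ?thesis .
qed

text \<open>The earlier a match starts, the longer it is, so the leftmost alive start
  \<open>p\<close> gives the overlap \<open>t - p\<close>. Only \<open>q\<close> with
  \<open>t - q < length S\<close> must be dead, since \<open>overlap\<close> ranges over proper
  prefixes.\<close>

lemma next_letter_leftmost:
  assumes "p \<le> t" "t \<le> length W" "t - p < length S"
    and alive: "\<And>m. m < t - p \<Longrightarrow> W ! (p + m) = S ! m"
    and dead: "\<And>q. q < p \<Longrightarrow> t - q < length S \<Longrightarrow> \<exists>m<t - q. W ! (q + m) \<noteq> S ! m"
  shows "next_letter S (take t W) = S ! (t - p)"
proof -
  let ?I = "{i. i < length S \<and> suffix (take i S) (take t W)}"
  have "Max ?I = t - p"
  proof (rule Max_eqI)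
    show "finite ?I" by simp
    show "t - p \<in> ?I"
      using assms suffix_take_iff[of p t W S] by auto
    fix i assume i: "i \<in> ?I"
    then have "i \<le> t"
      using suffix_length_le[of "take i S" "take t W"] assms by auto
    show "i \<le> t - p"
    proof (rule ccontr)
      assume "\<not> i \<le> t - p"
      with \<open>i \<le> t\<close> \<open>p \<le> t\<close> have "t - i < p" "t - (t - i) = i" by auto
      then show False
        using dead[of "t - i"] suffix_take_iff[of "t - i" t W S] i assms by auto
    qed
  qed
  then show ?thesis
    by (simp add: next_letter_def overlap_def)
qed

text \<open>\<open>W\<close> need not be the output: it may contain \<open>B\<close> early, in which case the game is over sooner.\<close>

lemma bob_wins_script:
  assumes Bob: "sublist B W"
    and noA: "\<And>q. q + length A \<le> length W \<Longrightarrow> \<exists>m<length A. W ! (q + m) \<noteq> A ! m"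
    and alice: "\<And>t. t < length W \<Longrightarrow> even t \<Longrightarrow> next_letter A (take t W) = W ! t"
    and bob: "\<And>t. t < length W \<Longrightarrow> odd t \<Longrightarrow> next_letter B (take t W) = W ! t"
  shows "bob_wins A B"
proof (rule ccontr)
  assume no_win: "\<not> bob_wins A B"
  have noA': "\<not> sublist A W"
  proof
    assume "sublist A W"
    then obtain X Y where W: "W = X @ A @ Y" by (auto simp: sublist_def)
    then have "length X + length A \<le> length W" by simp
    from noA[OF this] show False by (auto simp: W nth_append)
  qed
  \<comment> \<open>By \<open>noA'\<close> and \<open>no_win\<close> neither string occurs while the
    output follows \<open>W\<close>, so it follows \<open>W\<close> to the end, where
    \<open>B\<close> does occur.\<close>
  have "game_output A B t = take t W" if "t \<le> length W" for t
    using that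
  proof (induction t)
    case (Suc t)
    have "\<not> sublist A (take t W)"
      using noA' sublist_order.order.trans[OF _ sublist_take] by blast
    moreover from this have "\<not> sublist B (take t W)"
      using no_win Suc unfolding bob_wins_def by (metis Suc_leD)
    ultimately have "\<not> game_over A B (take t W)"
      by (simp add: game_over_def)
    with Suc alice[of t] bob[of t] show ?case
      by (simp add: Let_def take_Suc_conv_app_nth)
  qed simp
  from this[of "length W"] Bob noA' no_win show False
    unfolding bob_wins_def by (metis order_refl take_all)
qed

section \<open>Even length, and tails that drop one letter\<close>

lemma force_loss_even:
  fixes B :: "coin list"
  assumes "even (length B)" "B \<noteq> []"
  shows "\<exists>A. length A = length B \<and> A \<noteq> B \<and> bob_wins A B"
proof -
  let ?n = "length B"
  obtain c where c: "c \<noteq> B ! (?n - 1)" by (cases "B ! (?n - 1)") auto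
  define A where "A = B[?n - 1 := c]"
  have n: "0 < ?n" using assms by simp
  have len: "length A = ?n" by (simp add: A_def)
  have diff: "A ! (?n - 1) \<noteq> B ! (?n - 1)" using c n by (simp add: A_def)
  have "bob_wins A B"
  proof (rule bob_wins_script[of B B])
    fix q assume "q + length A \<le> length B"
    then have "q = 0" by (simp add: len)
    then show "\<exists>m<length A. B ! (q + m) \<noteq> A ! m"
      using diff n by (auto simp: len intro!: exI[of _ "?n - 1"])
  next
    fix t assume t: "t < length B" "even t"
    with assms have "t \<noteq> ?n - 1" using n by (metis Suc_diff_1 even_Suc)
    then show "next_letter A (take t B) = B ! t"
      using t next_letter_leftmost[of 0 t B A] by (simp add: len) (simp add: A_def)
  next
    fix t assume "t < length B"
    then show "next_letter B (take t B) = B ! t"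
      using next_letter_leftmost[of 0 t B B] by simp
  qed simp
  with len diff show ?thesis by metis
qed

lemma force_loss_even_run:
  assumes "even r" "0 < r" "r < length B"
    and H: "\<And>i. i < r \<Longrightarrow> B ! i = H" and T: "B ! r = T"
  shows "\<exists>A. length A = length B \<and> A \<noteq> B \<and> bob_wins A B"
proof -
  define A where "A = tl B @ [H]"
  have len: "length A = length B" using assms by (simp add: A_def)
  have A: "A ! m = B ! Suc m" if "Suc m < length B" for m
    using that by (auto simp: A_def nth_append nth_tl)
  have AH: "A ! m = H" if "Suc m < r" for m using A H that assms by simp
  have AT: "A ! (r - 1) = T" using A[of "r - 1"] T assms by simp
  \<comment> \<open>Start 0 dies for Alice at offset \<open>r - 1\<close>, where \<open>A\<close>
    has \<open>T\<close> against the \<open>H\<close> of \<open>B\<close>; start 1 then takes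
    over.\<close>
  have start: "\<exists>m<t. B ! m \<noteq> A ! m" if "r \<le> t" for t
    using that assms H[of "r - 1"] AT by (intro exI[of _ "r - 1"]) auto
  have "bob_wins A B"
  proof (rule bob_wins_script[of B B])
    fix q assume "q + length A \<le> length B"
    then have "q = 0" by (simp add: len)
    then show "\<exists>m<length A. B ! (q + m) \<noteq> A ! m"
      using start[of "length B"] assms by (simp add: len)
  next
    fix t assume t: "t < length B" "even t"
    show "next_letter A (take t B) = B ! t"
    proof (cases "t < r")
      case True
      \<comment> \<open>Both \<open>t\<close> and \<open>r\<close> are even, so Alice never moves at
        \<open>r - 1\<close>, where she would end the run with \<open>T\<close>.\<close>
      with t assms have "Suc t < r" by (metis Suc_lessI even_Suc)
      then show ?thesis
        using next_letter_leftmost[of 0 t B A] t by (simp add: len AH H)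
    next
      case False
      have "next_letter A (take t B) = A ! (t - 1)"
        by (rule next_letter_leftmost) (use t False assms start[of t] in \<open>auto simp: len A\<close>)
      then show ?thesis using False assms t A[of "t - 1"] by simp
    qed
  next
    fix t assume "t < length B"
    then show "next_letter B (take t B) = B ! t"
      using next_letter_leftmost[of 0 t B B] by simp
  qed simp
  moreover have "A \<noteq> B" using AT H[of "r - 1"] assms by auto
  ultimately show ?thesis using len by blast
qed

lemma force_loss_odd_run:
  assumes "odd r" "r + 2 \<le> length B"
    and H: "\<And>i. i < r \<Longrightarrow> B ! i = H" and T: "B ! r = T" "B ! (r + 1) = T"
  shows "\<exists>A. length A = length B \<and> A \<noteq> B \<and> bob_wins A B"
proof -
  define A where "A = tl B @ [H]"
  \<comment> \<open>The prefix has odd length \<open>r\<close>: Alice, moving at the even index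
    \<open>r - 1\<close>, plays its \<open>T\<close>, and Bob opens the copy of
    \<open>B\<close>.\<close>
  define W where "W = (replicate (r - 1) H @ [T]) @ B"
  have r: "0 < r" using assms by (simp add: odd_pos)
  have len: "length A = length B" using assms by (simp add: A_def)
  have lenW: "length W = r + length B" using r by (simp add: W_def)
  have A: "A ! m = B ! Suc m" if "Suc m < length B" for m
    using that by (auto simp: A_def nth_append nth_tl)
  have AH: "A ! m = H" if "Suc m < r" for m using A H that assms by simp
  have AT: "A ! (r - 1) = T" "A ! r = T" using A[of "r - 1"] A[of r] T assms r by simp_all
  have WH: "W ! i = H" if "i < r - 1" for i using that by (simp add: W_def nth_append)
  have WT: "W ! (r - 1) = T" by (simp add: W_def nth_append)
  have WB: "W ! (r + i) = B ! i" for i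
    using nth_append_length_plus[of "replicate (r - 1) H @ [T]" B i] r by (simp add: W_def)
  \<comment> \<open>Start 0 dies at offset \<open>r\<close>, where \<open>A\<close> has the second
    \<open>T\<close> of \<open>B\<close> but Bob restarts with \<open>H\<close>; the other starts
    die at the \<open>T\<close> in position \<open>r - 1\<close>.\<close>
  have dead1: "\<exists>m<t - q. W ! (q + m) \<noteq> A ! m" if "r < t" "q < r" for t q
  proof (cases "q = 0")
    case True
    then show ?thesis using that AT WB[of 0] H[of 0] r by (intro exI[of _ r]) auto
  next
    case False
    then show ?thesis using that WT AH[of "r - 1 - q"] by (intro exI[of _ "r - 1 - q"]) auto
  qed
  have dead2: "\<exists>m<t - r. W ! (r + m) \<noteq> A ! m" if "2 * r \<le> t" for t
    using that AT WB[of "r - 1"] H[of "r - 1"] r by (intro exI[of _ "r - 1"]) auto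
  have deadB: "\<exists>m<t - q. W ! (q + m) \<noteq> B ! m" if "r \<le> t" "q < r" for t q
    using that WT H[of "r - 1 - q"] by (intro exI[of _ "r - 1 - q"]) auto
  have "bob_wins A B"
  proof (rule bob_wins_script[of B W])
    show "sublist B W" unfolding W_def by (rule sublist_append_leftI)
  next
    fix q assume q: "q + length A \<le> length W"
    then consider "q < r" | "q = r" by (force simp: len lenW)
    then show "\<exists>m<length A. W ! (q + m) \<noteq> A ! m"
    proof cases
      case 1
      with dead1[of "q + length A" q] assms show ?thesis by (simp add: len)
    next
      case 2
      with dead2[of "r + length A"] assms show ?thesis by (simp add: len)
    qed
  next
    fix t assume t: "t < length W" "even t"
    then consider "t \<le> r - 1" | k where "t = r + k" "k < r" "odd k" | k where "t = r + k" "r \<le> k"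
      using assms(1) r by (metis Suc_diff_1 even_add le_add_diff_inverse less_Suc_eq_le not_less)
    then show "next_letter A (take t W) = W ! t"
    proof cases
      case 1
      have "next_letter A (take t W) = A ! (t - 0)"
        by (rule next_letter_leftmost) (use 1 t assms in \<open>auto simp: len AH WH\<close>)
      also have "\<dots> = W ! t"
        using 1 AT WT AH[of t] WH[of t] by (cases "t = r - 1") auto
      finally show ?thesis .
    next
      case 2
      \<comment> \<open>\<open>k\<close> is odd and \<open>r - 1\<close> even, so it is not Alice's
        turn where start \<open>r\<close> would make her play \<open>T\<close>.\<close>
      have k: "Suc k < r" using 2 assms(1) by (metis Suc_lessI even_Suc)
      have "next_letter A (take t W) = A ! (t - r)"
      proof (rule next_letter_leftmost)
        fix q assume "q < r"
        then show "\<exists>m<t - q. W ! (q + m) \<noteq> A ! m"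
          using dead1[of t q] 2 by (simp add: odd_pos)
      qed (use 2 k t assms in \<open>auto simp: len AH WB H\<close>)
      then show ?thesis using 2 k by (simp add: AH WB H)
    next
      case 3
      have k: "k < length B" using 3 t lenW by simp
      have "next_letter A (take t W) = A ! (t - Suc r)"
      proof (rule next_letter_leftmost)
        fix q assume "q < Suc r"
        then show "\<exists>m<t - q. W ! (q + m) \<noteq> A ! m"
          using dead1[of t q] dead2[of t] 3 r by (cases "q = r") auto
      next
        fix m assume "m < t - Suc r"
        then show "W ! (Suc r + m) = A ! m"
          using WB[of "Suc m"] A[of m] 3 k by simp
      qed (use 3 r k t in \<open>auto simp: len\<close>)
      then show ?thesis using 3 r k A[of "k - 1"] WB[of k] by simp
    qed
  next
    fix t assume t: "t < length W" "odd t"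
    show "next_letter B (take t W) = W ! t"
    proof (cases "t < r")
      case True
      then have "t < r - 1"
        using t assms(1) r by (metis Suc_diff_1 even_Suc less_antisym)
      then show ?thesis
        using next_letter_leftmost[of 0 t W B] t assms by (simp add: WH H)
    next
      case False
      have "next_letter B (take t W) = B ! (t - r)"
      proof (rule next_letter_leftmost)
        fix q assume "q < r"
        then show "\<exists>m<t - q. W ! (q + m) \<noteq> B ! m"
          using deadB[of t q] False by simp
      qed (use False t lenW in \<open>auto simp: WB\<close>)
      then show ?thesis using WB[of "t - r"] False by simp
    qed
  qed
  moreover have "A \<noteq> B" using AT H[of "r - 1"] r by auto
  ultimately show ?thesis using len by blast
qed

section \<open>Strings starting with \<open>HT\<close>\<close>

text \<open>If no letter of \<open>W\<close> is repeated, this applies with \<open>e = length W\<close>.\<close>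

lemma next_letter_alternating:
  assumes alt: "\<And>i. i < e \<Longrightarrow> (W ! i = c) = even i"
    and e: "even e \<or> e = length W"
    and A: "A ! 0 = c" "A ! 1 = c" "2 \<le> length A"
    and tail: "\<And>m. e + m < length W \<Longrightarrow> A ! m = W ! (e + m)"
    and lenW: "length W \<le> e + length A"
    and t: "even t" "t < length W"
  shows "next_letter A (take t W) = W ! t"
proof -
  \<comment> \<open>As \<open>A\<close> opens with \<open>cc\<close>, an odd start fails at once and
    an even one at its second letter, which still lies before \<open>e\<close>, by parity or because
    \<open>W\<close> ends there.\<close>
  have dead: "\<exists>m<t - q. W ! (q + m) \<noteq> A ! m" if "q < t" "q < e" for q
  proof (cases "even q")
    case True
    from True t that have "Suc q < t" by (metis Suc_lessI even_Suc)
    moreover from True e that \<open>Suc q < t\<close> t have "Suc q < e"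
      by (metis Suc_lessI even_Suc less_trans)
    ultimately show ?thesis
      using True A alt[of "Suc q"] by (intro exI[of _ 1]) auto
  next
    case False
    then show ?thesis using that A alt[of q] by (intro exI[of _ 0]) auto
  qed
  show ?thesis
  proof (cases "t < e")
    case True
    \<comment> \<open>No earlier start is alive, so the match is empty and Alice plays her first
      letter \<open>c\<close>.\<close>
    have "next_letter A (take t W) = A ! (t - t)"
      by (rule next_letter_leftmost) (use t A dead True in auto)
    then show ?thesis using A alt[of t] t True by simp
  next
    case False
    have "next_letter A (take t W) = A ! (t - e)"
      by (rule next_letter_leftmost) (use t False dead tail lenW in auto)
    then show ?thesis using tail[of "t - e"] t False by simp
  qed
qed

lemma force_loss_HT:
  assumes "2 \<le> length B" and B01: "B ! 0 = H" "B ! 1 = T"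
  shows "\<exists>A. length A = length B \<and> A \<noteq> B \<and> bob_wins A B"
proof -
  let ?n = "length B"
  obtain d where "d \<le> ?n" and alt: "\<And>i. i < d \<Longrightarrow> (B ! i = H) = even i"
    and d: "d = ?n \<or> Suc d < ?n \<and> (B ! d = H) = even d \<and> B ! Suc d = B ! d"
  proof -
    have step: "(B ! i = H) = even i"
      if "\<And>j. j < i \<Longrightarrow> B ! Suc j \<noteq> B ! j" for i
      using that
    proof (induction i)
      case (Suc i)
      then show ?case
        using Suc.prems[of i] by (cases "B ! i"; cases "B ! Suc i") auto
    qed (simp add: B01)
    show thesis
    proof (cases "\<exists>i. Suc i < ?n \<and> B ! Suc i = B ! i")
      case True
      define d where "d = (LEAST i. Suc i < ?n \<and> B ! Suc i = B ! i)"
      have d: "Suc d < ?n \<and> B ! Suc d = B ! d"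
        unfolding d_def using True by (rule LeastI_ex)
      have ne: "B ! Suc j \<noteq> B ! j" if "j < d" for j
        using not_less_Least[of j] that d unfolding d_def by fastforce
      have "(B ! i = H) = even i" if "i \<le> d" for i
        by (rule step) (use ne that in simp)
      with d show thesis by (intro that[of d]) auto
    next
      case False
      then show thesis by (intro that[of ?n] step) auto
    qed
  qed
  define A where "A = drop d B @ replicate d H"
  have len: "length A = ?n" using \<open>d \<le> ?n\<close> by (simp add: A_def)
  have A: "A ! m = B ! (d + m)" if "d + m < ?n" for m
    using that by (auto simp: A_def nth_append)
  have "bob_wins A B \<and> A \<noteq> B"
  proof (cases "d = ?n \<or> even d")
    case True
    have A01: "A ! 0 = H" "A ! 1 = H"
      using d A[of 0] A[of 1] True \<open>2 \<le> ?n\<close>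
      by (auto simp: A_def simp del: length_greater_0_conv)
    have "bob_wins A B"
    proof (rule bob_wins_script[of B B])
      fix q assume "q + length A \<le> ?n"
      then show "\<exists>m<length A. B ! (q + m) \<noteq> A ! m"
        using A01 B01 assms by (intro exI[of _ 1]) (simp add: len)
    next
      fix t assume "t < ?n" "even t"
      then show "next_letter A (take t B) = B ! t"
        using True A01 A alt assms \<open>d \<le> ?n\<close>
        by (intro next_letter_alternating[where e = d and c = H]) (auto simp: len)
    next
      fix t assume "t < ?n"
      then show "next_letter B (take t B) = B ! t"
        using next_letter_leftmost[of 0 t B B] by simp
    qed simp
    then show ?thesis using A01 B01 by force
  next
    case False
    then have "B ! d = T" using d by (cases "B ! d") auto
    then have A01: "A ! 0 = T" "A ! 1 = T"
      using d A[of 0] A[of 1] False by auto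
    \<comment> \<open>Prepending \<open>T\<close> moves the pair \<open>TT\<close> from the odd
      index \<open>d\<close> to the even index \<open>Suc d\<close>, as
      \<open>next_letter_alternating\<close> requires.\<close>
    have alt': "((T # B) ! i = T) = even i" if "i < Suc d" for i
      using alt[of "i - 1"] that by (cases i; cases "B ! (i - 1)") auto
    have "bob_wins A B"
    proof (rule bob_wins_script[of B "T # B"])
      show "sublist B (T # B)" by (simp add: sublist_Cons_right)
    next
      fix q assume "q + length A \<le> length (T # B)"
      then have "q = 0 \<or> q = 1" by (auto simp: len)
      then show "\<exists>m<length A. (T # B) ! (q + m) \<noteq> A ! m"
        using A01 B01 assms by (intro exI[of _ "1 - q"]) (auto simp: len)
    next
      fix t assume "t < length (T # B)" "even t"
      then show "next_letter A (take t (T # B)) = (T # B) ! t"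
        using False A01 A alt' assms \<open>d \<le> ?n\<close>
        by (intro next_letter_alternating[where e = "Suc d" and c = T]) (auto simp: len)
    next
      fix t assume t: "t < length (T # B)" "odd t"
      have "next_letter B (take t (T # B)) = B ! (t - 1)"
        by (rule next_letter_leftmost) (use t B01 odd_pos[of t] in auto)
      then show "next_letter B (take t (T # B)) = (T # B) ! t"
        using t by (cases t) auto
    qed
    then show ?thesis using A01 B01 by force
  qed
  with len show ?thesis by blast
qed

theorem theorem10:
  fixes n :: nat and B :: "coin list"
  assumes "n \<ge> 1" and "length B = n"
    and "even n
      \<or> prefix [H, T] B
      \<or> (let r = length (takeWhile (\<lambda>c. c = H) B) in r > 0 \<and> even r)
      \<or> (\<exists>x\<ge>1. odd x \<and> x + 2 \<le> n \<and> (\<forall>i<x. B ! i = H) \<and> B ! x = T \<and> B ! (x + 1) = T)"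
  shows "\<exists>A. length A = n \<and> A \<noteq> B \<and> bob_wins A B"
proof -
  let ?r = "length (takeWhile (\<lambda>c. c = H) B)"
  consider "even n" | "prefix [H, T] B" | "odd n" "?r > 0" "even ?r"
    | x where "odd x" "x + 2 \<le> n" "\<forall>i<x. B ! i = H" "B ! x = T" "B ! (x + 1) = T"
    using assms(3) by (auto simp: Let_def)
  then show ?thesis
  proof cases
    case 1
    then show ?thesis using force_loss_even[of B] assms(1,2) by force
  next
    case 2
    then show ?thesis using force_loss_HT[of B] assms(2) by (auto simp: prefix_def)
  next
    case 3
    \<comment> \<open>An even run cannot fill a string of odd length, so a \<open>T\<close> ends
      it.\<close>
    have "?r < length B"
      using 3 assms(2) length_takeWhile_le[of "\<lambda>c. c = H" B] by (cases "?r = n") auto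
    moreover from this have "B ! ?r = T"
      using nth_length_takeWhile[of "\<lambda>c. c = H" B] by (cases "B ! ?r") auto
    moreover have "B ! i = H" if "i < ?r" for i
      using that takeWhile_nth[of i "\<lambda>c. c = H" B] nth_mem[OF that] set_takeWhileD by fastforce
    ultimately show ?thesis using force_loss_even_run[of ?r B] 3 assms(2) by auto
  next
    case 4
    then show ?thesis using force_loss_odd_run[of x B] assms(2) by simp
  qed
qed

end
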